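(* Let $H$ be a real Hilbert space, $K\ge 2$, and let $A_1,\dots,A_K\subset H$ be closed convex sets with $A_1\cap\dots\cap A_K=\{0\}$. Let $i(n)\in\{1,\dots,K\}$, $n=1,2,\dots$, be a sequence containing each $k\in\{1,\dots,K\}$ infinitely often, let $x_0\in H$, let $x_n=P_{i(n)}x_{n-1}$ for $n\ge 1$, and let $W$ be the set of all partial weak limits of $\{x_n\}$. If $K\le 3$, then $W=\{0\}$.
   Context: $P_i$ denotes the metric (nearest point) projection of $H$ onto $A_i$. A partial weak limit of $\{x_n\}$ is the weak limit of some subsequence of $\{x_n\}$. *)

theory Defs
  imports "HOL-Analysis.Analysis"
begin

text \<open>
  The library's \<open>closest_point\<close> is restricted to Heine-Borel spaces, i.e. in this setting to
  finite dimension, so the nearest point projection is defined here for arbitrary inner product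
  spaces.  The description is well defined when \<open>S\<close> is nonempty, closed and convex and the space
  is complete.
\<close>

definition metric_proj :: "'a::real_inner set \<Rightarrow> 'a \<Rightarrow> 'a"
  where "metric_proj S a = (THE p. p \<in> S \<and> (\<forall>y\<in>S. dist a p \<le> dist a y))"

definition weakly_converges :: "(nat \<Rightarrow> 'a::real_normed_vector) \<Rightarrow> 'a \<Rightarrow> bool"
  where "weakly_converges x l \<longleftrightarrow>
    (\<forall>f::'a \<Rightarrow> real. bounded_linear f \<longrightarrow> (\<lambda>n. f (x n)) \<longlonglongrightarrow> f l)"

definition partial_weak_limits :: "(nat \<Rightarrow> 'a::real_normed_vector) \<Rightarrow> 'a set"
  where "partial_weak_limits x = {l. \<exists>r. strict_mono r \<and> weakly_converges (x \<circ> r) l}"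

end

theory Submission
  imports Defs
begin

text \<open>
  A projection onto a closed convex set containing \<open>z\<close> brings a point closer to \<open>z\<close>, and the
  gain in squared distance is at least the squared length of the step.  With \<open>z = 0\<close> this shows
  that the squared norms of the iterates decrease to a limit \<open>L\<close> and that the steps tend to \<open>0\<close>.

  Let \<open>w\<close> be the weak limit of \<open>x (u j)\<close>.  After passing to a subsequence all \<open>x (u j)\<close> lie in one
  set \<open>A a\<close>, and the next set visited after it is always the same \<open>A b\<close>.  Only one vanishing step
  separates the two visits and closed convex sets are weakly closed, so \<open>w\<close> lies in \<open>A a \<inter> A b\<close>.
  With two sets this is \<open>{0}\<close>.

  With a third set \<open>A c\<close>, let \<open>m j\<close> be the first time after \<open>u j\<close> at which \<open>A c\<close> is visited.
  Before that time only \<open>A a\<close> and \<open>A b\<close> are used, alternating apart from repetitions that do not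
  move the point; so \<open>x (m j)\<close> is within two late steps of points of both of these sets
  (\<open>set_visited_before_is_near\<close>).  A weak limit of a subsequence of \<open>x (m j)\<close>, which exists by
  weak compactness (\<open>bounded_imp_weakly_convergent_subsequence\<close>), is thus common to all three
  sets, that is, it is \<open>0\<close>; the same holds for \<open>x (m j - 1)\<close>.  On the other hand \<open>w\<close> lies in both
  sets used between \<open>u j\<close> and \<open>m j - 1\<close>, hence
  \<open>norm (x (m j - 1) - w) \<le> norm (x (u j) - w)\<close>.
  Squaring and expanding, the squared norms of both iterates tend to \<open>L\<close>, while their inner
  products with \<open>w\<close> tend to \<open>0\<close> and to \<open>inner w w\<close>.  The limit of the inequality is
  \<open>L \<le> L - 2 * inner w w\<close>, which forces \<open>w = 0\<close>
  (\<open>weak_limit_zero_if_at_most_three\<close>).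
\<close>

section \<open>Nearest points in closed convex sets\<close>

text \<open>
  By the parallelogram law, points of \<open>S\<close> whose distances from \<open>a\<close> are nearly minimal are close to
  each other: otherwise their midpoint would be too close to \<open>a\<close>.  So the almost nearest points form
  nested closed sets with diameters tending to \<open>0\<close>, and completeness gives a common point.
\<close>

lemma nearest_point_exists:
  fixes S :: "'a::{real_inner, complete_space} set"
  assumes "closed S" "convex S" "S \<noteq> {}"
  shows "\<exists>p\<in>S. \<forall>y\<in>S. dist a p \<le> dist a y"
proof -
  define d where "d = infdist a S"
  define T where "T n = S \<inter> cball a (d + 1 / real (Suc n))" for n
  have d_le: "d \<le> dist a y" if "y \<in> S" for y
    unfolding d_def using that by (rule infdist_le)
  have d_nonneg: "0 \<le> d" by (simp add: d_def infdist_nonneg)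
  have diameter: "(dist p q)\<^sup>2 \<le> 4 * ((d + 1 / real (Suc n))\<^sup>2 - d\<^sup>2)" if "p \<in> T n" "q \<in> T n" for p q n
  proof -
    let ?e = "1 / real (Suc n)"
    have pq: "p \<in> S" "q \<in> S" "norm (p - a) \<le> d + ?e" "norm (q - a) \<le> d + ?e"
      using that by (auto simp: T_def dist_norm norm_minus_commute)
    have "midpoint p q \<in> S"
      using pq convexD[OF assms(2), of p q "1/2" "1/2"]
      by (simp add: midpoint_def scaleR_add_right)
    then have "d \<le> norm (midpoint p q - a)"
      using d_le by (metis dist_commute dist_norm)
    then have "d\<^sup>2 \<le> (norm (midpoint p q - a))\<^sup>2"
      using d_nonneg by (simp add: power_mono)
    moreover have "(norm (p - a))\<^sup>2 \<le> (d + ?e)\<^sup>2" "(norm (q - a))\<^sup>2 \<le> (d + ?e)\<^sup>2"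
      using pq by (simp_all add: power_mono)
    moreover have "(dist p q)\<^sup>2
        = 2 * (norm (p - a))\<^sup>2 + 2 * (norm (q - a))\<^sup>2 - 4 * (norm (midpoint p q - a))\<^sup>2"
      unfolding dist_norm power2_norm_eq_inner midpoint_def
      by (simp add: inner_diff_left inner_diff_right inner_add_left inner_add_right
          inner_commute field_simps)
    ultimately show ?thesis by (simp add: algebra_simps)
  qed
  have "\<exists>p. \<forall>n. p \<in> T n"
  proof (rule decreasing_closed_nest[of T])
    show "closed (T n)" for n using assms(1) by (simp add: T_def closed_Int)
    show "T n \<noteq> {}" for n
    proof -
      have "(INF y\<in>S. dist a y) < d + 1 / real (Suc n)"
        using assms(3) by (simp add: d_def infdist_notempty)
      then obtain y where "y \<in> S" "dist a y < d + 1 / real (Suc n)"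
        using cInf_lessD[of "dist a ` S"] assms(3) by auto
      then show ?thesis by (auto simp: T_def intro!: exI[of _ y])
    qed
    show "T n \<subseteq> T m" if "m \<le> n" for m n
    proof -
      have "1 / real (Suc n) \<le> 1 / real (Suc m)" using that by (simp add: frac_le)
      then show ?thesis unfolding T_def by auto
    qed
    show "\<exists>n. \<forall>p\<in>T n. \<forall>q\<in>T n. dist p q < \<epsilon>" if "\<epsilon> > 0" for \<epsilon>
    proof -
      have "(\<lambda>n. 4 * ((d + 1 / real (Suc n))\<^sup>2 - d\<^sup>2)) \<longlonglongrightarrow> 4 * ((d + 0)\<^sup>2 - d\<^sup>2)"
        by (intro tendsto_mult tendsto_diff tendsto_power tendsto_add tendsto_const
            LIMSEQ_Suc[OF lim_1_over_n])
      then have "\<forall>\<^sub>F n in sequentially. 4 * ((d + 1 / real (Suc n))\<^sup>2 - d\<^sup>2) < \<epsilon>\<^sup>2"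
        by (rule order_tendstoD(2)) (use that in simp)
      then obtain n where n: "4 * ((d + 1 / real (Suc n))\<^sup>2 - d\<^sup>2) < \<epsilon>\<^sup>2"
        using eventually_happens sequentially_bot by blast
      then have "dist p q < \<epsilon>" if "p \<in> T n" "q \<in> T n" for p q
        using power2_less_imp_less[of "dist p q" \<epsilon>] diameter[OF that] n \<open>\<epsilon> > 0\<close> by linarith
      then show ?thesis by blast
    qed
  qed blast
  then obtain p where p: "\<And>n. p \<in> T n" by blast
  have "dist a p \<le> d"
  proof (rule LIMSEQ_le_const)
    show "(\<lambda>n. d + 1 / real (Suc n)) \<longlonglongrightarrow> d"
      using LIMSEQ_inverse_real_of_nat_add[of d] by (simp add: inverse_eq_divide)
    show "\<exists>N. \<forall>n\<ge>N. dist a p \<le> d + 1 / real (Suc n)" using p by (auto simp: T_def)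
  qed
  moreover have "p \<in> S" using p[of 0] by (simp add: T_def)
  ultimately show ?thesis using d_le by force
qed

lemma metric_proj_nearest:
  fixes S :: "'a::{real_inner, complete_space} set"
  assumes "closed S" "convex S" "S \<noteq> {}"
  shows "metric_proj S a \<in> S" "\<forall>y\<in>S. dist a (metric_proj S a) \<le> dist a y"
proof -
  have "\<exists>!p. p \<in> S \<and> (\<forall>y\<in>S. dist a p \<le> dist a y)"
    using nearest_point_exists[OF assms, of a] any_closest_point_unique[OF assms(2,1)] by blast
  from theI'[OF this] show "metric_proj S a \<in> S" "\<forall>y\<in>S. dist a (metric_proj S a) \<le> dist a y"
    unfolding metric_proj_def by blast+
qed

lemma metric_proj_obtuse:
  fixes S :: "'a::{real_inner, complete_space} set"
  assumes "closed S" "convex S" "y \<in> S"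
  shows "inner (a - metric_proj S a) (y - metric_proj S a) \<le> 0"
  using any_closest_point_dot[of S "metric_proj S a" y a] metric_proj_nearest[of S a] assms by blast

text \<open>
  The angle at the projection is obtuse, so the law of cosines becomes an inequality.
\<close>

lemma metric_proj_pythagoras:
  fixes S :: "'a::{real_inner, complete_space} set"
  assumes "closed S" "convex S" "y \<in> S"
  shows "(norm (metric_proj S a - y))\<^sup>2 + (norm (metric_proj S a - a))\<^sup>2 \<le> (norm (a - y))\<^sup>2"
  using metric_proj_obtuse[OF assms, of a]
  unfolding power2_norm_eq_inner
  by (simp add: inner_diff_left inner_diff_right inner_commute)

section \<open>Weak convergence and weak compactness in Hilbert space\<close>

lemma weakly_converges_inner:
  fixes l :: "'a::real_inner"
  assumes "weakly_converges u l"
  shows "(\<lambda>n. inner (u n) y) \<longlonglongrightarrow> inner l y"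
  using assms bounded_linear_inner_left unfolding weakly_converges_def by blast

lemma weakly_converges_subsequence:
  assumes "weakly_converges u l" "strict_mono r"
  shows "weakly_converges (u \<circ> r) l"
  using assms LIMSEQ_subseq_LIMSEQ unfolding weakly_converges_def o_def by blast

lemma weakly_converges_perturb:
  assumes "weakly_converges u l" "(\<lambda>n. v n - u n) \<longlonglongrightarrow> 0"
  shows "weakly_converges v l"
  unfolding weakly_converges_def
proof (intro allI impI)
  fix f :: "'a \<Rightarrow> real" assume f: "bounded_linear f"
  have "(\<lambda>n. f (u n) + f (v n - u n)) \<longlonglongrightarrow> f l + f 0"
    using assms f bounded_linear.tendsto[OF f] unfolding weakly_converges_def
    by (intro tendsto_add) auto
  moreover have "f (u n) + f (v n - u n) = f (v n)" for n
    using linear_add[OF bounded_linear.linear[OF f], of "u n" "v n - u n"] by simp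
  ultimately show "(\<lambda>n. f (v n)) \<longlonglongrightarrow> f l"
    by (simp add: linear_0 bounded_linear.linear f)
qed

text \<open>
  If \<open>p\<close> is the projection of the limit \<open>l\<close>, then \<open>C\<close> lies in the half-space
  \<open>inner (l - p) (y - p) \<le> 0\<close>.  Weak limits stay in half-spaces, so \<open>y = l\<close> is allowed, and \<open>l = p\<close>.
\<close>

lemma weak_limit_in_closed_convex:
  fixes C :: "'a::{real_inner, complete_space} set"
  assumes "closed C" "convex C" "\<And>n. u n \<in> C" "weakly_converges u l"
  shows "l \<in> C"
proof -
  define p where "p = metric_proj C l"
  have "(\<lambda>n. inner (u n) (l - p) - inner p (l - p)) \<longlonglongrightarrow> inner l (l - p) - inner p (l - p)"
    by (intro tendsto_intros weakly_converges_inner assms)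
  then have "inner l (l - p) - inner p (l - p) \<le> 0"
    using metric_proj_obtuse[OF assms(1,2,3), of l]
    by (intro LIMSEQ_le_const2[of _ _ 0])
      (auto simp: p_def inner_diff_left inner_diff_right inner_commute)
  then have "inner (l - p) (l - p) \<le> 0" by (simp add: inner_diff_left)
  then have "l = p" by (metis inner_ge_zero inner_eq_zero_iff order_antisym right_minus_eq)
  then show ?thesis using metric_proj_nearest(1)[of C l] assms(1,2,3) p_def by auto
qed

text \<open>
  The point of the hyperplane \<open>f y = 1\<close> nearest to the origin is orthogonal to the kernel of \<open>f\<close>,
  and hence represents \<open>f\<close> up to a factor.
\<close>

lemma riesz_representation:
  fixes f :: "'a::{real_inner, complete_space} \<Rightarrow> real"
  assumes f: "bounded_linear f"
  shows "\<exists>l. \<forall>y. f y = inner l y"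
proof (cases "\<exists>z. f z \<noteq> 0")
  case False
  then show ?thesis by (auto intro: exI[of _ 0])
next
  case True
  note lin = bounded_linear.linear[OF f]
  obtain z where z: "f z \<noteq> 0" using True by blast
  define S where "S = {y. f y = 1}"
  define p where "p = metric_proj S 0"
  have "(1 / f z) *\<^sub>R z \<in> S" using z by (simp add: S_def linear_scale[OF lin])
  moreover have "closed S"
    unfolding S_def using f by (intro closed_Collect_eq continuous_intros linear_continuous_on)
  moreover have "convex S"
    unfolding S_def convex_def by (simp add: linear_add[OF lin] linear_scale[OF lin])
  ultimately have "p \<in> S" and "\<And>y. y \<in> S \<Longrightarrow> inner (0 - p) (y - p) \<le> 0"
    using metric_proj_nearest(1)[of S 0] metric_proj_obtuse[of S _ 0] unfolding p_def by auto
  then have p: "f p = 1" and obtuse: "\<And>y. f y = 1 \<Longrightarrow> inner p p \<le> inner p y"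
    by (auto simp: S_def inner_diff_right)
  have "p \<noteq> 0" using p linear_0[OF lin] by (metis zero_neq_one)
  have orth: "inner p v = 0" if "f v = 0" for v
    using obtuse[of "p + v"] obtuse[of "p - v"] that p
    by (simp add: linear_add[OF lin] linear_diff[OF lin] inner_add_right inner_diff_right)
  have "f y = inner ((1 / inner p p) *\<^sub>R p) y" for y
    using orth[of "y - f y *\<^sub>R p"] p \<open>p \<noteq> 0\<close>
    by (simp add: linear_diff[OF lin] linear_scale[OF lin] inner_diff_right)
  then show ?thesis by blast
qed

text \<open>
  Tychonoff's theorem takes the place of a diagonal argument: a countable product of compact
  intervals is compact and first countable, hence sequentially compact.
\<close>

lemma bounded_sequences_converge_jointly:
  fixes g :: "nat \<Rightarrow> nat \<Rightarrow> real"
  assumes "\<And>n m. \<bar>g n m\<bar> \<le> M m"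
  shows "\<exists>r::nat\<Rightarrow>nat. strict_mono r \<and> (\<forall>m. convergent (\<lambda>n. g (r n) m))"
proof -
  let ?B = "PiE UNIV (\<lambda>m. {- M m..M m})"
  have "compactin (product_topology (\<lambda>_. euclidean) UNIV) ?B"
    by (simp add: compactin_PiE)
  then have "seq_compact ?B"
    by (intro compact_imp_seq_compact) (simp add: euclidean_product_topology)
  moreover have "g n \<in> ?B" for n using assms[of n] by (auto simp: abs_le_iff minus_le_iff)
  ultimately obtain l r where "strict_mono (r::nat\<Rightarrow>nat)" and lim: "(g \<circ> r) \<longlonglongrightarrow> l"
    unfolding seq_compact_def by metis
  moreover have "(\<lambda>n. g (r n) m) \<longlonglongrightarrow> l m" for m
    using continuous_on_tendsto_compose[OF continuous_on_product_coordinates lim, of m]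
    by (simp add: o_def)
  ultimately show ?thesis unfolding convergent_def by blast
qed

text \<open>
  The space may fail to be separable, so a subsequence is chosen for which only the inner products
  with the terms of the sequence itself converge.  The vectors \<open>y\<close> for which
  \<open>inner (u (r n)) y\<close> converges form a closed subspace \<open>S\<close> that contains all these terms.  Replacing
  an arbitrary \<open>y\<close> by its projection onto \<open>S\<close> does not change the inner products, so \<open>S\<close> is the
  whole space.  The limit is a bounded functional of \<open>y\<close>, and its Riesz representative is the weak
  limit.
\<close>

lemma bounded_imp_weakly_convergent_subsequence:
  fixes u :: "nat \<Rightarrow> 'a::{real_inner, complete_space}"
  assumes bound: "\<And>n. norm (u n) \<le> M"
  shows "\<exists>r l. strict_mono r \<and> weakly_converges (u \<circ> r) l"
proof -
  have "\<bar>inner (u n) (u m)\<bar> \<le> M * norm (u m)" for n m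
    using Cauchy_Schwarz_ineq2[of "u n" "u m"] mult_right_mono[OF bound[of n] norm_ge_zero[of "u m"]]
    by linarith
  then obtain r where r: "strict_mono (r::nat\<Rightarrow>nat)"
    and conv: "\<And>m. convergent (\<lambda>n. inner (u (r n)) (u m))"
    using bounded_sequences_converge_jointly[of "\<lambda>n m. inner (u n) (u m)" "\<lambda>m. M * norm (u m)"]
    by blast
  define S where "S = {y. convergent (\<lambda>n. inner (u (r n)) y)}"
  have lincomb: "s *\<^sub>R y + t *\<^sub>R z \<in> S" if "y \<in> S" "z \<in> S" for s t y z
    using that unfolding S_def
    by (auto simp: inner_add_right intro!: convergent_add convergent_mult convergent_const)
  have "closed S"
    unfolding closed_sequential_limits
  proof (intro allI impI, elim conjE)
    fix v y assume v: "\<forall>k. v k \<in> S" and lim_v: "v \<longlonglongrightarrow> y"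
    have "Cauchy (\<lambda>n. inner (u (r n)) y)"
    \<comment> \<open>the functionals \<open>inner (u (r n))\<close> are uniformly Lipschitz, with constant \<open>M\<close>\<close>
    proof (rule metric_CauchyI)
      fix e :: real assume "e > 0"
      have "(\<lambda>k. M * norm (v k - y)) \<longlonglongrightarrow> M * norm (y - y)" using lim_v by (intro tendsto_intros)
      then have "\<forall>\<^sub>F k in sequentially. M * norm (v k - y) < e / 3"
        using \<open>e > 0\<close> by (intro order_tendstoD) auto
      then obtain k where k: "M * norm (v k - y) < e / 3"
        using eventually_happens sequentially_bot by blast
      have close: "\<bar>inner (u (r n)) (v k) - inner (u (r n)) y\<bar> < e / 3" for n
        using Cauchy_Schwarz_ineq2[of "u (r n)" "v k - y"] k
          mult_right_mono[OF bound[of "r n"] norm_ge_zero[of "v k - y"]]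
        by (simp add: inner_diff_right)
      have "Cauchy (\<lambda>n. inner (u (r n)) (v k))"
        using v by (simp add: S_def convergent_Cauchy)
      then obtain N where N: "\<And>m n. m \<ge> N \<Longrightarrow> n \<ge> N \<Longrightarrow>
          dist (inner (u (r m)) (v k)) (inner (u (r n)) (v k)) < e / 3"
        using \<open>e > 0\<close> metric_CauchyD[of _ "e / 3"] by (metis divide_pos_pos zero_less_numeral)
      have "dist (inner (u (r m)) y) (inner (u (r n)) y) < e" if "m \<ge> N" "n \<ge> N" for m n
        using N[OF that] close[of m] close[of n] unfolding dist_real_def by linarith
      then show "\<exists>N. \<forall>m\<ge>N. \<forall>n\<ge>N. dist (inner (u (r m)) y) (inner (u (r n)) y) < e" by blast
    qed
    then show "y \<in> S" by (simp add: S_def Cauchy_convergent)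
  qed
  moreover have "convex S" unfolding convex_def using lincomb by blast
  moreover have "u 0 \<in> S" using conv by (simp add: S_def)
  ultimately have P: "metric_proj S y \<in> S" "\<And>z. z \<in> S \<Longrightarrow> inner (y - metric_proj S y) (z - metric_proj S y) \<le> 0" for y
    using metric_proj_nearest(1)[of S y] metric_proj_obtuse[of S _ y] by auto
  have all: "y \<in> S" for y
  proof -
    define p where "p = metric_proj S y"
    have orth: "inner (u (r n)) (y - p) = 0" for n
    proof -
      have "u (r n) \<in> S" "p \<in> S" using conv P by (simp_all add: S_def p_def)
      then show ?thesis
        using P(2)[of "1 *\<^sub>R p + 1 *\<^sub>R u (r n)" y] P(2)[of "1 *\<^sub>R p + (-1) *\<^sub>R u (r n)" y]
          lincomb[of p "u (r n)" 1 1] lincomb[of p "u (r n)" 1 "-1"]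
        by (simp add: p_def inner_commute)
    qed
    have "(\<lambda>n. inner (u (r n)) y) = (\<lambda>n. inner (u (r n)) p)"
      using orth by (simp add: inner_diff_right)
    then show ?thesis using P(1)[of y] by (simp add: S_def p_def)
  qed
  define f where "f y = lim (\<lambda>n. inner (u (r n)) y)" for y
  have lim: "(\<lambda>n. inner (u (r n)) y) \<longlonglongrightarrow> f y" for y
    using all[of y] by (simp add: S_def f_def convergent_LIMSEQ_iff)
  have "bounded_linear f"
  proof (rule bounded_linear_intro[where K = M])
    show "f (y + z) = f y + f z" for y z
      by (rule LIMSEQ_unique[OF lim]) (simp add: inner_add_right tendsto_add lim)
    show "f (c *\<^sub>R y) = c *\<^sub>R f y" for c y
      by (rule LIMSEQ_unique[OF lim]) (simp add: tendsto_mult lim)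
    show "norm (f y) \<le> norm y * M" for y
    proof (rule LIMSEQ_le_const2[OF tendsto_norm[OF lim]])
      have "norm (inner (u (r n)) y) \<le> norm y * M" for n
        using Cauchy_Schwarz_ineq2[of "u (r n)" y]
          mult_right_mono[OF bound[of "r n"] norm_ge_zero[of y]]
        by (simp add: mult.commute)
      then show "\<exists>N. \<forall>n\<ge>N. norm (inner (u (r n)) y) \<le> norm y * M" by blast
    qed
  qed
  then obtain l where l: "\<And>y. f y = inner l y" using riesz_representation by metis
  have "weakly_converges (u \<circ> r) l"
    unfolding weakly_converges_def
  proof (intro allI impI)
    fix g :: "'a \<Rightarrow> real" assume "bounded_linear g"
    then obtain y where "\<And>z. g z = inner y z" using riesz_representation by metis
    then show "(\<lambda>n. g ((u \<circ> r) n)) \<longlonglongrightarrow> g l"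
      using lim[of y] l[of y] by (simp add: inner_commute)
  qed
  then show ?thesis using r by blast
qed

section \<open>Iterated nearest point projections\<close>

locale projection_iteration =
  fixes I :: "'k set"
    and A :: "'k \<Rightarrow> 'a::{real_inner, complete_space} set"
    and i :: "nat \<Rightarrow> 'k"
    and x :: "nat \<Rightarrow> 'a"
  assumes finite_I: "finite I"
    and closed_A: "k \<in> I \<Longrightarrow> closed (A k)"
    and convex_A: "k \<in> I \<Longrightarrow> convex (A k)"
    and zero_in_A: "k \<in> I \<Longrightarrow> 0 \<in> A k"
    and index_in: "n \<ge> 1 \<Longrightarrow> i n \<in> I"
    and index_recurs: "k \<in> I \<Longrightarrow> infinite {n. n \<ge> 1 \<and> i n = k}"
    and step: "n \<ge> 1 \<Longrightarrow> x n = metric_proj (A (i n)) (x (n - 1))"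
begin

lemma iterate_in: "n \<ge> 1 \<Longrightarrow> x n \<in> A (i n)"
  using metric_proj_nearest(1)[of "A (i n)"] closed_A convex_A zero_in_A index_in[of n] step[of n]
  by fastforce

lemma step_pythagoras:
  assumes "z \<in> A (i (Suc n))"
  shows "(norm (x (Suc n) - z))\<^sup>2 + (norm (x (Suc n) - x n))\<^sup>2 \<le> (norm (x n - z))\<^sup>2"
  using metric_proj_pythagoras[OF closed_A convex_A assms, of "x n"] index_in[of "Suc n"] step[of "Suc n"]
  by simp

lemma norm_decreasing: "(norm (x (Suc n)))\<^sup>2 + (norm (x (Suc n) - x n))\<^sup>2 \<le> (norm (x n))\<^sup>2"
  using step_pythagoras[of 0 n] zero_in_A index_in[of "Suc n"] by simp

lemma norm_converges: "convergent (\<lambda>n. (norm (x n))\<^sup>2)"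
proof -
  have "(norm (x (Suc n)))\<^sup>2 \<le> (norm (x n))\<^sup>2" for n
    using norm_decreasing[of n] zero_le_power2[of "norm (x (Suc n) - x n)"] by linarith
  then have "decseq (\<lambda>n. (norm (x n))\<^sup>2)" by (rule decseq_SucI)
  then obtain L where "(\<lambda>n. (norm (x n))\<^sup>2) \<longlonglongrightarrow> L"
    using decseq_convergent[of "\<lambda>n. (norm (x n))\<^sup>2" 0] by auto
  then show ?thesis by (rule convergentI)
qed

lemma norm_bounded: "norm (x n) \<le> norm (x 0)"
proof (induction n)
  case (Suc n)
  have "(norm (x (Suc n)))\<^sup>2 \<le> (norm (x n))\<^sup>2"
    using norm_decreasing[of n] zero_le_power2[of "norm (x (Suc n) - x n)"] by linarith
  then have "norm (x (Suc n)) \<le> norm (x n)" by simp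
  with Suc show ?case by simp
qed simp

lemma step_tendsto_0: "(\<lambda>n. norm (x (Suc n) - x n)) \<longlonglongrightarrow> 0"
proof -
  obtain L where L: "(\<lambda>n. (norm (x n))\<^sup>2) \<longlonglongrightarrow> L" using norm_converges convergent_def by blast
  have drop: "(\<lambda>n. (norm (x n))\<^sup>2 - (norm (x (Suc n)))\<^sup>2) \<longlonglongrightarrow> 0"
    using tendsto_diff[OF L LIMSEQ_Suc[OF L]] by simp
  have "(norm (x (Suc n) - x n))\<^sup>2 \<le> (norm (x n))\<^sup>2 - (norm (x (Suc n)))\<^sup>2" for n
    using norm_decreasing[of n] by simp
  then have "(\<lambda>n. (norm (x (Suc n) - x n))\<^sup>2) \<longlonglongrightarrow> 0"
    by (intro Lim_null_comparison[OF _ drop] always_eventually) simp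
  then have "(\<lambda>n. sqrt ((norm (x (Suc n) - x n))\<^sup>2)) \<longlonglongrightarrow> sqrt 0"
    by (rule tendsto_real_sqrt)
  then show ?thesis by (simp only: real_sqrt_pow2 real_sqrt_abs abs_norm_cancel real_sqrt_zero)
qed

lemma repeated_index_fixes:
  assumes "n \<ge> 1" "i (Suc n) = i n"
  shows "x (Suc n) = x n"
  using step_pythagoras[of "x n" n] iterate_in[OF assms(1)] assms(2)
  by (simp add: sum_power2_le_zero_iff)

lemma constant_index_fixes:
  assumes "1 \<le> n" "n \<le> m" "\<And>q. n \<le> q \<Longrightarrow> q \<le> m \<Longrightarrow> i q = k"
  shows "x m = x n"
  using assms(2,3)
proof (induction m rule: dec_induct)
  case (step m)
  then have "x (Suc m) = x m" using assms(1) by (intro repeated_index_fixes) auto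
  with step show ?case by simp
qed simp

text \<open>
  A bound by two steps is the form in which closeness arises below: one step leaves a set, one step
  enters a set, and in between the sequence does not move.
\<close>

definition within_two_steps :: "nat \<Rightarrow> 'a \<Rightarrow> 'a \<Rightarrow> bool"
  where "within_two_steps n y z \<longleftrightarrow>
    (\<exists>p\<ge>n. \<exists>q\<ge>n. norm (y - z) \<le> norm (x (Suc p) - x p) + norm (x (Suc q) - x q))"

lemma within_one_stepI:
  assumes "n \<le> p" "norm (y - z) \<le> norm (x (Suc p) - x p)"
  shows "within_two_steps n y z"
proof -
  have "norm (y - z) \<le> norm (x (Suc p) - x p) + norm (x (Suc p) - x p)"
    using assms(2) norm_ge_zero[of "x (Suc p) - x p"] by linarith
  then show ?thesis unfolding within_two_steps_def using assms(1) by blast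
qed

lemma within_two_steps_tendsto_0:
  assumes "filterlim t at_top sequentially" "\<And>j. within_two_steps (t j) (y j) (z j)"
  shows "(\<lambda>j. y j - z j) \<longlonglongrightarrow> 0"
proof -
  obtain p q where pq: "\<And>j. t j \<le> p j" "\<And>j. t j \<le> q j"
    "\<And>j. norm (y j - z j) \<le> norm (x (Suc (p j)) - x (p j)) + norm (x (Suc (q j)) - x (q j))"
    using assms(2) unfolding within_two_steps_def by metis
  have "filterlim p at_top sequentially" "filterlim q at_top sequentially"
    using pq(1,2) by (auto intro: filterlim_at_top_mono[OF assms(1)])
  then have "(\<lambda>j. norm (x (Suc (p j)) - x (p j)) + norm (x (Suc (q j)) - x (q j))) \<longlonglongrightarrow> 0 + 0"
    by (intro tendsto_add filterlim_compose[OF step_tendsto_0])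
  then show ?thesis
    using pq(3) by (intro Lim_null_comparison[of "\<lambda>j. y j - z j"]) (auto intro: always_eventually)
qed

section \<open>Weak limits of the iterates\<close>

lemma first_later_index:
  assumes "k \<in> I" "k \<in> J"
  obtains m where "m > n" "i m \<in> J" "\<And>p. n < p \<Longrightarrow> p < m \<Longrightarrow> i p \<notin> J"
proof -
  have "\<exists>m. m > n \<and> i m \<in> J"
    using index_recurs[OF assms(1)] assms(2) unfolding infinite_nat_iff_unbounded by blast
  then obtain m where "m > n \<and> i m \<in> J" "\<And>p. p < m \<Longrightarrow> \<not> (p > n \<and> i p \<in> J)"
    using exists_least_iff[of "\<lambda>m. m > n \<and> i m \<in> J"] by blast
  then show thesis using that by blast
qed

text \<open>
  Take the last visit to \<open>A k\<close> before time \<open>m\<close>.  After it only \<open>A k'\<close> is used up to time \<open>m - 1\<close>,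
  so the point moves at most twice: when it leaves \<open>A k\<close> and in the step to time \<open>m\<close>.
\<close>

lemma set_visited_before_is_near:
  assumes "1 \<le> n" "\<And>p. n \<le> p \<Longrightarrow> p < m \<Longrightarrow> i p = k \<or> i p = k'"
    and "n \<le> v" "v < m" "i v = k"
  shows "\<exists>p. n \<le> p \<and> i p = k \<and> within_two_steps n (x p) (x m)"
proof -
  let ?V = "{p. n \<le> p \<and> p < m \<and> i p = k}"
  define p where "p = Max ?V"
  have fin: "finite ?V" by (rule finite_subset[of _ "{..<m}"]) auto
  have "p \<in> ?V" unfolding p_def using assms fin by (intro Max_in) auto
  then have p: "n \<le> p" "p < m" "i p = k" by auto
  have last: "i q = k'" if "p < q" "q < m" for q
    using assms(2)[of q] that p Max_ge[OF fin, of q] unfolding p_def by fastforce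
  have "norm (x p - x m) \<le> norm (x (Suc p) - x p) + norm (x (Suc (m - 1)) - x (m - 1))"
  proof (cases "Suc p = m")
    case True
    then show ?thesis by (auto simp: norm_minus_commute)
  next
    case False
    have "x (m - 1) = x (Suc p)"
      using False p assms(1) last by (intro constant_index_fixes[where k = k']) auto
    moreover have "norm (x p - x m) \<le> norm (x p - x (m - 1)) + norm (x (m - 1) - x m)"
      using norm_triangle_ineq[of "x p - x (m - 1)" "x (m - 1) - x m"] by simp
    ultimately show ?thesis using p by (simp add: norm_minus_commute)
  qed
  moreover have "n \<le> m - 1" using p by simp
  ultimately show ?thesis unfolding within_two_steps_def using p by blast
qed

text \<open>
  From each \<open>r (Suc j)\<close> on, the index is constant up to some first change.  There are finitely many
  pairs of an old and a new index, so one pair occurs for infinitely many \<open>j\<close>.  The shift to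
  \<open>Suc j\<close> keeps away from time \<open>0\<close>, at which \<open>i\<close> is arbitrary.
\<close>

lemma constant_switch_along_subsequence:
  fixes r :: "nat \<Rightarrow> nat"
  assumes "strict_mono r" "k \<in> I" "k' \<in> I" "k \<noteq> k'"
  obtains a b s q where "a \<in> I" "b \<in> I" "a \<noteq> b" "strict_mono (s :: nat \<Rightarrow> nat)"
    "\<And>j. 1 \<le> r (s j)" "\<And>j. r (s j) < q j" "\<And>j. i (q j) = b"
    "\<And>j p. r (s j) \<le> p \<Longrightarrow> p < q j \<Longrightarrow> i p = a"
proof -
  have pos: "1 \<le> r (Suc j)" for j using strict_mono_imp_increasing[OF assms(1), of "Suc j"] by linarith
  have "\<exists>m>r (Suc j). i m \<noteq> i (r (Suc j)) \<and> (\<forall>p. r (Suc j) < p \<and> p < m \<longrightarrow> i p = i (r (Suc j)))" for j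
  proof -
    obtain l where "l \<in> I" "l \<in> - {i (r (Suc j))}" using assms(2-4) by blast
    from first_later_index[OF this, of "r (Suc j)"] show ?thesis by (metis ComplD ComplI singletonD singletonI)
  qed
  then obtain m where m: "\<And>j. r (Suc j) < m j" "\<And>j. i (m j) \<noteq> i (r (Suc j))"
    "\<And>j p. r (Suc j) < p \<Longrightarrow> p < m j \<Longrightarrow> i p = i (r (Suc j))"
    by metis
  define f where "f j = (i (r (Suc j)), i (m j))" for j
  have "i (m j) \<in> I" for j using m(1)[of j] by (intro index_in) linarith
  then have "range f \<subseteq> I \<times> I" using pos index_in by (auto simp: f_def)
  then have "finite (range f)" using finite_I by (meson finite_SigmaI finite_subset)
  then obtain j0 where "infinite {j. f j = f j0}"
    using pigeonhole_infinite[of "UNIV :: nat set" f] by auto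
  then obtain s where s: "strict_mono (s :: nat \<Rightarrow> nat)" "\<And>j. f (s j) = f j0"
    using infinite_enumerate[of "{j. f j = f j0}"] by auto
  show thesis
  proof (rule that[of "i (r (Suc j0))" "i (m j0)" "Suc \<circ> s" "m \<circ> s"])
    show "i (r (Suc j0)) \<in> I" "i (m j0) \<in> I"
      using \<open>range f \<subseteq> I \<times> I\<close> unfolding f_def by auto
    show "i (r (Suc j0)) \<noteq> i (m j0)" using m(2)[of j0] by simp
    show "strict_mono (Suc \<circ> s)" using s(1) by (simp add: strict_mono_def)
    show "i p = i (r (Suc j0))" if "r ((Suc \<circ> s) j) \<le> p" "p < (m \<circ> s) j" for j p
      using m(3)[of "s j" p] s(2)[of j] that by (cases "p = r (Suc (s j))") (auto simp: f_def)
  qed (use pos m(1) s(2) in \<open>auto simp: f_def\<close>)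
qed

text \<open>
  Fejer monotonicity towards a point that belongs to every set used on the way.
\<close>

lemma distance_decreasing:
  assumes "n \<le> m" "\<And>p. n < p \<Longrightarrow> p \<le> m \<Longrightarrow> z \<in> A (i p)"
  shows "(norm (x m - z))\<^sup>2 \<le> (norm (x n - z))\<^sup>2"
  using assms
proof (induction m rule: dec_induct)
  case (step m)
  have "(norm (x (Suc m) - z))\<^sup>2 \<le> (norm (x m - z))\<^sup>2"
    using step_pythagoras[of z m] step.hyps step.prems[of "Suc m"]
      zero_le_power2[of "norm (x (Suc m) - x m)"] by linarith
  also have "(norm (x m - z))\<^sup>2 \<le> (norm (x n - z))\<^sup>2"
    using step.IH step.prems by simp
  finally show ?case .
qed simp

text \<open>
  The bound three enters through \<open>i_before\<close>: until the third set is visited, only two sets are in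
  use, and the weak limit \<open>w\<close> belongs to both.  Therefore the iterates do not move away from \<open>w\<close>
  up to a time at which they are weakly close to \<open>0\<close>.
\<close>

lemma weak_limit_zero_if_at_most_three:
  fixes r :: "nat \<Rightarrow> nat"
  assumes card: "2 \<le> card I" "card I \<le> 3"
    and Inter: "(\<Inter>k\<in>I. A k) = {0}"
    and r: "strict_mono r" "weakly_converges (x \<circ> r) w"
  shows "w = 0"
proof -
  obtain k k' where "k \<in> I" "k' \<in> I" "k \<noteq> k'"
    using card(1) card_le_Suc0_iff_eq[OF finite_I] by force
  then obtain a b s q where ab: "a \<in> I" "b \<in> I" "a \<noteq> b" and s: "strict_mono (s :: nat \<Rightarrow> nat)"
    and pos: "\<And>j. 1 \<le> r (s j)" and q: "\<And>j. r (s j) < q j" "\<And>j. i (q j) = b"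
    and at_a: "\<And>j p. r (s j) \<le> p \<Longrightarrow> p < q j \<Longrightarrow> i p = a"
    using constant_switch_along_subsequence[OF r(1)] by metis
  define u where "u j = r (s j)" for j
  have u_mono: "strict_mono u" using r(1) s by (simp add: u_def strict_mono_def)
  have u_lim: "filterlim u at_top sequentially" using u_mono by (rule filterlim_subseq)
  have u_weak: "weakly_converges (\<lambda>j. x (u j)) w"
    using weakly_converges_subsequence[OF r(2) s] by (simp add: o_def u_def)
  have iu: "i (u j) = a" for j using at_a[of j "u j"] q(1)[of j] by (simp add: u_def)
  have w_a: "w \<in> A a"
  proof (rule weak_limit_in_closed_convex[OF _ _ _ u_weak])
    show "x (u j) \<in> A a" for j using iterate_in[of "u j"] iu[of j] pos[of j] by (simp add: u_def)
  qed (use closed_A convex_A ab in auto)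
  have w_b: "w \<in> A b"
  proof (rule weak_limit_in_closed_convex[of "A b" "\<lambda>j. x (q j)"])
    show "weakly_converges (\<lambda>j. x (q j)) w"
    proof (rule weakly_converges_perturb[OF u_weak], rule within_two_steps_tendsto_0[OF u_lim])
      fix j
      have "x (q j - 1) = x (u j)"
        using q(1)[of j] pos[of j] at_a[of j] unfolding u_def
        by (intro constant_index_fixes[where k = a]) auto
      then have "norm (x (q j) - x (u j)) \<le> norm (x (Suc (q j - 1)) - x (q j - 1))"
        using q(1)[of j] by simp
      moreover have "u j \<le> q j - 1" using q(1)[of j] by (simp add: u_def)
      ultimately show "within_two_steps (u j) (x (q j)) (x (u j))" by (intro within_one_stepI)
    qed
    show "x (q j) \<in> A b" for j using iterate_in[of "q j"] q[of j] by simp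
  qed (use closed_A convex_A ab in auto)
  show ?thesis
  proof (cases "I = {a, b}")
    case True
    then show ?thesis using Inter w_a w_b by auto
  next
    case False
    then obtain c where c: "c \<in> I" "c \<noteq> a" "c \<noteq> b" using ab by blast
    have "card {a, b, c} = 3" using ab c by auto
    then have I: "I = {a, b, c}"
      using card_seteq[OF finite_I, of "{a, b, c}"] ab c card(2) by auto
    have "\<exists>m>u j. i m = c \<and> (\<forall>p. u j < p \<and> p < m \<longrightarrow> i p \<noteq> c)" for j
      using first_later_index[OF c(1), of "{c}" "u j"] by (metis singletonD singletonI)
    then obtain m where m: "\<And>j. u j < m j" "\<And>j. i (m j) = c"
      "\<And>j p. u j < p \<Longrightarrow> p < m j \<Longrightarrow> i p \<noteq> c"
      by metis
    have i_before: "i p = a \<or> i p = b" if "u j \<le> p" "p < m j" for j p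
      using that m(3)[of j p] iu[of j] index_in[of p] pos[of j] I
      by (cases "p = u j") (auto simp: u_def)
    have q_before: "q j < m j" for j
      using at_a[of j "m j"] m(1,2)[of j] q(2)[of j] c unfolding u_def
      by (metis less_imp_le_nat linorder_neqE_nat)
    have near: "\<exists>p. (\<forall>j. u j \<le> p j \<and> i (p j) = k) \<and> (\<lambda>j. x (p j) - x (m j)) \<longlonglongrightarrow> 0"
      if k: "k = a \<or> k = b" for k
    proof -
      have "\<exists>p. u j \<le> p \<and> i p = k \<and> within_two_steps (u j) (x p) (x (m j))" for j
      proof (rule set_visited_before_is_near)
        show "1 \<le> u j" using pos by (simp add: u_def)
        show "i p = k \<or> i p = (if k = a then b else a)" if "u j \<le> p" "p < m j" for p
          using i_before[OF that] k by auto
        show "u j \<le> (if k = a then u j else q j)" using q(1)[of j] by (simp add: u_def)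
        show "(if k = a then u j else q j) < m j" using m(1) q_before by simp
        show "i (if k = a then u j else q j) = k" using k iu q(2) by auto
      qed
      then obtain p where p: "\<And>j. u j \<le> p j" "\<And>j. i (p j) = k"
        "\<And>j. within_two_steps (u j) (x (p j)) (x (m j))"
        by metis
      show ?thesis
        using p(1,2) within_two_steps_tendsto_0[OF u_lim p(3)] by (intro exI[of _ p]) simp
    qed
    obtain t v where t: "strict_mono (t :: nat \<Rightarrow> nat)" and v: "weakly_converges (\<lambda>j. x (m (t j))) v"
      using bounded_imp_weakly_convergent_subsequence[of "\<lambda>j. x (m j)" "norm (x 0)"] norm_bounded
      by (auto simp: o_def)
    have v_in: "v \<in> A k" if k: "k = a \<or> k = b" for k
    proof -
      obtain p where p: "\<And>j. u j \<le> p j" "\<And>j. i (p j) = k" "(\<lambda>j. x (p j) - x (m j)) \<longlonglongrightarrow> 0"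
        using near[OF k] by blast
      show ?thesis
      proof (rule weak_limit_in_closed_convex[of "A k" "\<lambda>j. x (p (t j))"])
        show "weakly_converges (\<lambda>j. x (p (t j))) v"
          using LIMSEQ_subseq_LIMSEQ[OF p(3) t] by (intro weakly_converges_perturb[OF v]) (simp add: o_def)
        show "x (p (t j)) \<in> A k" for j
          using iterate_in[of "p (t j)"] p(1,2)[of "t j"] pos[of "t j"] by (simp add: u_def)
      qed (use closed_A convex_A ab k in auto)
    qed
    have "v \<in> A c"
    proof (rule weak_limit_in_closed_convex[OF _ _ _ v])
      show "x (m (t j)) \<in> A c" for j
        using iterate_in[of "m (t j)"] m(1,2)[of "t j"] by simp
    qed (use closed_A convex_A c in auto)
    with v_in have "v = 0" using Inter I by auto
    \<comment> \<open>\<open>w\<close> need not belong to \<open>A c\<close>, so the distances to \<open>w\<close> are compared only up to the last time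
      before \<open>A c\<close> is visited\<close>
    define p where "p j = m j - 1" for j
    have p: "u j \<le> p j" "p j < m j" "Suc (p j) = m j" for j using m(1)[of j] by (auto simp: p_def)
    have "(\<lambda>j. x (p j) - x (m j)) \<longlonglongrightarrow> 0"
    proof (rule within_two_steps_tendsto_0[OF u_lim])
      fix j
      show "within_two_steps (u j) (x (p j)) (x (m j))"
        using p(1,3)[of j] by (intro within_one_stepI[of _ "p j"]) (auto simp: norm_minus_commute)
    qed
    from LIMSEQ_subseq_LIMSEQ[OF this t] have "weakly_converges (\<lambda>j. x (p (t j))) v"
      by (intro weakly_converges_perturb[OF v]) (simp add: o_def)
    with \<open>v = 0\<close> have p_weak: "weakly_converges (\<lambda>j. x (p (t j))) 0" by simp
    have "w \<in> A (i l)" if "u j < l" "l \<le> p j" for l j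
      using i_before[of j l] that p(2)[of j] w_a w_b by auto
    then have "(norm (x (p j) - w))\<^sup>2 \<le> (norm (x (u j) - w))\<^sup>2" for j
      using p(1) by (intro distance_decreasing) auto
    then have ineq: "(norm (x (p j)))\<^sup>2 - 2 * inner (x (p j)) w \<le> (norm (x (u j)))\<^sup>2 - 2 * inner (x (u j)) w" for j
      by (simp add: power2_norm_eq_inner inner_diff_left inner_diff_right inner_commute)
    obtain L where L: "(\<lambda>n. (norm (x n))\<^sup>2) \<longlonglongrightarrow> L" using norm_converges convergent_def by blast
    have ut_lim: "filterlim (\<lambda>j. u (t j)) at_top sequentially"
      using filterlim_compose[OF u_lim filterlim_subseq[OF t]] .
    then have pt_lim: "filterlim (\<lambda>j. p (t j)) at_top sequentially"
      using p(1) by (auto intro: filterlim_at_top_mono)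
    have "(\<lambda>j. (norm (x (p (t j))))\<^sup>2 - 2 * inner (x (p (t j))) w) \<longlonglongrightarrow> L - 2 * inner 0 w"
      by (intro tendsto_diff tendsto_mult tendsto_const filterlim_compose[OF L pt_lim]
          weakly_converges_inner[OF p_weak])
    moreover have "(\<lambda>j. (norm (x (u (t j))))\<^sup>2 - 2 * inner (x (u (t j))) w) \<longlonglongrightarrow> L - 2 * inner w w"
      using weakly_converges_subsequence[OF u_weak t]
      by (intro tendsto_diff tendsto_mult tendsto_const filterlim_compose[OF L ut_lim]
          weakly_converges_inner) (simp add: o_def)
    ultimately have "L - 2 * inner 0 w \<le> L - 2 * inner w w"
      using ineq by (intro LIMSEQ_le) auto
    then have "inner w w \<le> 0" by simp
    then show ?thesis by (metis inner_ge_zero inner_eq_zero_iff order_antisym)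
  qed
qed

theorem partial_weak_limits_eq_zero:
  assumes "2 \<le> card I" "card I \<le> 3" "(\<Inter>k\<in>I. A k) = {0}"
  shows "partial_weak_limits x = {0}"
proof -
  obtain r l where "strict_mono r" "weakly_converges (x \<circ> r) l"
    using bounded_imp_weakly_convergent_subsequence[of x, OF norm_bounded] by blast
  then show ?thesis
    unfolding partial_weak_limits_def using weak_limit_zero_if_at_most_three[OF assms] by blast
qed

end

theorem corollary1p1:
  fixes A :: "nat \<Rightarrow> 'a::{real_inner, complete_space} set"
    and K :: nat
    and i :: "nat \<Rightarrow> nat"
    and x0 :: 'a
    and x :: "nat \<Rightarrow> 'a"
    and W :: "'a set"
  assumes "K \<ge> 2"
    and "\<And>k. k \<in> {1..K} \<Longrightarrow> closed (A k)"
    and "\<And>k. k \<in> {1..K} \<Longrightarrow> convex (A k)"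
    and "(\<Inter>k\<in>{1..K}. A k) = {0}"
    and "\<And>n. n \<ge> 1 \<Longrightarrow> i n \<in> {1..K}"
    and "\<And>k. k \<in> {1..K} \<Longrightarrow> infinite {n. n \<ge> 1 \<and> i n = k}"
    and "x 0 = x0"
    and "\<And>n. n \<ge> 1 \<Longrightarrow> x n = metric_proj (A (i n)) (x (n - 1))"
    and "W = partial_weak_limits x"
    and "K \<le> 3"
  shows "W = {0}"
proof -
  interpret projection_iteration "{1..K}" A i x
  proof
    show "0 \<in> A k" if "k \<in> {1..K}" for k
      using assms(4) that by blast
  qed (simp, fact assms(2), fact assms(3), fact assms(5), fact assms(6), fact assms(8))
  show ?thesis
    unfolding assms(9) by (rule partial_weak_limits_eq_zero) (use assms(1,4,10) in auto)
qed

end
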